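(* Let $a, b \in \mathbb{R}$ with $b - a \in \mathbb{N}_1$, let $1 < \nu < 2$, let $\alpha, \beta, \gamma, \delta \in \mathbb{R}$ with $\alpha^2 + \beta^2 > 0$, $\gamma^2 + \delta^2 > 0$, and let $q : \mathbb{N}_{a+1}^b \to \mathbb{R}$. Assume $\alpha, \beta, \gamma, \delta \geq 0$, $\beta \geq \alpha$, and $\xi \neq 0$, where $\xi = (\beta - \alpha)\gamma + \alpha\gamma H_{\nu-1}(b,a) + \alpha\delta H_{\nu-2}(b,a)$. If the nabla fractional boundary value problem $$\begin{cases} (\nabla_a^\nu u)(t) + q(t)u(t) = 0, & t \in \mathbb{N}_{a+2}^b,\\ \alpha u(a+1) - \beta(\nabla u)(a+1) = 0,\\ \gamma u(b) + \delta(\nabla u)(b) = 0,\end{cases}$$ has a nontrivial solution $u : \mathbb{N}_a^b \to \mathbb{R}$, then $$\sum_{s=a+1}^b |q(s)| > \frac{1}{\Omega},$$ where $$\Omega = \frac{1}{\xi}\Big[\alpha\gamma H_{\nu-1}(b,a)H_{\nu-1}(b,a) + \alpha\delta H_{\nu-1}(b,a) + (\beta-\alpha)\gamma H_{\nu-1}(b,a) + (\beta-\alpha)\delta\Big].$$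
   Context: Notation: $\mathbb{N}_c = \{c, c+1, c+2, \ldots\}$ and $\mathbb{N}_c^d = \{c, c+1, \ldots, d\}$ when $d - c$ is a nonnegative integer. The backward jump operator is $\rho(a) = a$ and $\rho(t) = t-1$ for $t \in \mathbb{N}_{a+1}$; throughout, for $s\in\mathbb{N}_{a+1}$, $\rho(s) = s-1$. The generalized rising function is $t^{\overline{r}} = \Gamma(t+r)/\Gamma(t)$ when $t$ and $t+r$ are not in $\{\ldots,-2,-1,0\}$, and $t^{\overline{r}} := 0$ when $t \in \{\ldots,-2,-1,0\}$ and $t+r \notin \{\ldots,-2,-1,0\}$. The nabla fractional Taylor monomial of order $\mu$ (with $\mu \notin \{\ldots,-2,-1\}$) is $H_\mu(t,c) = \frac{(t-c)^{\overline{\mu}}}{\Gamma(\mu+1)}$; in particular $H_\mu(c,c)=0$. Nabla operators: $(\nabla u)(t) = u(t) - u(t-1)$, $\nabla^2 = \nabla\nabla$; for $\mu>0$, $(\nabla_a^{-\mu}u)(t) = \sum_{s=a+1}^t H_{\mu-1}(t,\rho(s))u(s)$ for $t\in\mathbb{N}_a$ (equal to $0$ at $t=a$); for $1<\nu<2$, $(\nabla_a^\nu u)(t) = \big(\nabla^2(\nabla_a^{-(2-\nu)}u)\big)(t)$, $t \in \mathbb{N}_{a+2}$ (its value at $t$ depends only on $u(a+1),\ldots,u(t)$). Nontrivial means not identically zero. *)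

theory Defs
  imports "HOL-Analysis.Analysis"
begin

definition nats_from :: "real \<Rightarrow> real set" where
  "nats_from c = {c + real n | n. True}"

text \<open>This set is empty if \<open>d < c\<close>; in particular \<open>nats_betw (a + 2) b\<close> is empty for \<open>b = a + 1\<close>,
  and a sum over \<open>nats_betw (a + 1) a\<close> is zero.\<close>

definition nats_betw :: "real \<Rightarrow> real \<Rightarrow> real set" where
  "nats_betw c d = {t \<in> nats_from c. t \<le> d}"

definition back_jump :: "real \<Rightarrow> real \<Rightarrow> real" where
  "back_jump a t = (if t = a then a else t - 1)"

text \<open>The generalized rising function is left undefined in the literature if \<open>t + r\<close> is a pole of
  the Gamma function. The value 0 chosen here in that case is a mere convention: whenever the
  function is used below on the relevant domains, both \<open>t + r\<close> and \<open>t\<close> are positive.\<close>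

definition gen_rising :: "real \<Rightarrow> real \<Rightarrow> real" where
  "gen_rising t r =
     (if t \<notin> \<int>\<^sub>\<le>\<^sub>0 \<and> t + r \<notin> \<int>\<^sub>\<le>\<^sub>0 then Gamma (t + r) / Gamma t else 0)"

definition taylor_mono :: "real \<Rightarrow> real \<Rightarrow> real \<Rightarrow> real" where
  "taylor_mono \<mu> t c = gen_rising (t - c) \<mu> / Gamma (\<mu> + 1)"

definition nabla :: "(real \<Rightarrow> real) \<Rightarrow> real \<Rightarrow> real" where
  "nabla u t = u t - u (t - 1)"

text \<open>The sum of order \<open>\<mu> > 0\<close> based at \<open>a\<close>, i.e. the nabla operator of order \<open>-\<mu>\<close>.\<close>

definition nabla_frac_sum :: "real \<Rightarrow> real \<Rightarrow> (real \<Rightarrow> real) \<Rightarrow> real \<Rightarrow> real" where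
  "nabla_frac_sum a \<mu> u t =
     (\<Sum>s\<in>nats_betw (a + 1) t. taylor_mono (\<mu> - 1) t (back_jump a s) * u s)"

text \<open>The Riemann-Liouville difference of order \<open>\<nu>\<close>, for \<open>1 < \<nu> < 2\<close> and \<open>t \<in> nats_from (a + 2)\<close>.\<close>

definition nabla_frac_diff :: "real \<Rightarrow> real \<Rightarrow> (real \<Rightarrow> real) \<Rightarrow> real \<Rightarrow> real" where
  "nabla_frac_diff a \<nu> u t = nabla (nabla (nabla_frac_sum a (2 - \<nu>) u)) t"

end

theory Submission
  imports Defs "HOL-Computational_Algebra.Formal_Power_Series"
begin

text \<open>
  Write \<open>b = a + 1 + N\<close> and read a function on the grid \<open>a + 1, a + 2, \<dots>\<close> as a formal power series.
  The Taylor monomial of order \<open>\<mu>\<close> then becomes \<open>(1 - X)\<^sup>-\<^sup>\<mu>\<^sup>-\<^sup>1\<close>, the backward difference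
  becomes multiplication by \<open>1 - X\<close>, and the fractional difference of order \<open>\<nu>\<close> becomes, from
  \<open>a + 2\<close> on, multiplication by \<open>(1 - X)\<^sup>\<nu>\<close>. At \<open>a + 1\<close> the product has the coefficient
  \<open>u (a + 1)\<close>. Multiplication by \<open>(1 - X)\<^sup>-\<^sup>\<nu>\<close> inverts it and yields the variation of constants
  formula (\<open>variation_of_constants\<close>); multiplication by \<open>(1 - X)\<^sup>1\<^sup>-\<^sup>\<nu>\<close> yields the backward
  difference of \<open>u\<close>.

  The equation leaves just one free parameter on \<open>a + 1, \<dots>, b\<close>, namely \<open>u (a + 1)\<close>. For \<open>N > 0\<close>
  the right boundary condition determines it, and so \<open>u\<close> is an integral transform of \<open>q u\<close> with an
  explicit kernel \<open>green\<close>. The left boundary condition ties \<open>u a\<close> to \<open>u (a + 1)\<close>.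

  Put \<open>h = H\<^bsub>\<nu>-1\<^esub>(b, a)\<close> and \<open>D = \<gamma> h + \<delta> H\<^bsub>\<nu>-2\<^esub>(b, a)\<close>. Then
  \<open>\<Omega> = ((\<beta> - \<alpha>) (\<gamma> h + \<delta>) + \<alpha> h (\<gamma> h + \<delta>)) / ((\<beta> - \<alpha>) \<gamma> + \<alpha> D)\<close>
  is a weighted mediant of \<open>(\<gamma> h + \<delta>) / \<gamma>\<close> (infinite for \<open>\<gamma> = 0\<close>) and \<open>h (\<gamma> h + \<delta>) / D\<close>, and
  the kernel is strictly smaller in absolute value than both of them, hence than \<open>\<Omega>\<close>
  (\<open>abs_green_less\<close>). The estimate of the transform at a point where \<open>\<bar>u\<bar>\<close> is maximal gives the
  inequality. In the remaining case \<open>N = 0\<close> the two boundary conditions alone force \<open>u = 0\<close>.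
\<close>

unbundle no vec_syntax
unbundle fps_syntax

section \<open>The power series of the Taylor monomials\<close>

text \<open>The coefficients of \<open>(1 - X)\<^sup>-\<^sup>c\<close>. For \<open>c > 0\<close> they are the values of the Taylor monomial
  of order \<open>c - 1\<close>; negative integers \<open>c\<close> give the integer-order backward differences.\<close>

definition rising_coeff :: "real \<Rightarrow> nat \<Rightarrow> real" where
  "rising_coeff c k = pochhammer c k / fact k"

lemma rising_coeff_0 [simp]: "rising_coeff c 0 = 1"
  by (simp add: rising_coeff_def)

lemma rising_coeff_Suc: "rising_coeff c (Suc k) = rising_coeff c k * ((c + k) / (k + 1))"
  by (simp add: rising_coeff_def pochhammer_Suc field_simps)

lemma rising_coeff_pos: "c > 0 \<Longrightarrow> rising_coeff c k > 0"
  by (simp add: rising_coeff_def pochhammer_pos)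

lemma rising_coeff_less:
  assumes "c > 1" "j < k"
  shows "rising_coeff c j < rising_coeff c k"
proof -
  have "strict_mono (rising_coeff c)"
    unfolding strict_mono_Suc_iff
  proof
    fix n :: nat
    have "1 < (c + n) / (n + 1)"
      using assms by (simp add: field_simps)
    then have "rising_coeff c n * 1 < rising_coeff c n * ((c + n) / (n + 1))"
      using assms by (intro mult_strict_left_mono rising_coeff_pos) auto
    then show "rising_coeff c n < rising_coeff c (Suc n)"
      by (simp only: rising_coeff_Suc mult_1_right)
  qed
  then show ?thesis
    using assms by (simp add: strict_mono_less)
qed

lemma rising_coeff_le_1:
  assumes "0 < c" "c \<le> 1"
  shows "rising_coeff c k \<le> 1"
proof (induction k)
  case (Suc k)
  have "(c + k) / (k + 1) \<le> 1"
    using assms by (simp add: field_simps)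
  with Suc have "rising_coeff c k * ((c + k) / (k + 1)) \<le> 1 * 1"
    using assms by (intro mult_mono) auto
  then show ?case
    by (simp add: rising_coeff_Suc)
qed simp

definition rising_series :: "real \<Rightarrow> real fps" where
  "rising_series c = Abs_fps (rising_coeff c)"

text \<open>The exponent law is the Vandermonde identity for rising factorials.\<close>

lemma rising_series_mult: "rising_series c * rising_series d = rising_series (c + d)"
proof (rule fps_ext)
  fix n
  have "(\<Sum>i\<le>n. rising_coeff c i * rising_coeff d (n - i))
      = (\<Sum>i\<le>n. real (n choose i) * pochhammer c i * pochhammer d (n - i)) / fact n"
    unfolding sum_divide_distrib
    by (intro sum.cong) (auto simp: rising_coeff_def binomial_fact)
  then show "(rising_series c * rising_series d) $ n = rising_series (c + d) $ n"
    by (simp add: rising_series_def fps_mult_nth atLeast0AtMost pochhammer_binomial_sum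
        rising_coeff_def[of "c + d"])
qed

lemma rising_series_0: "rising_series 0 = 1"
  by (rule fps_ext) (simp add: rising_series_def rising_coeff_def pochhammer_0_left)

lemma rising_series_minus_1: "rising_series (- 1) = 1 - fps_X"
proof (rule fps_ext)
  fix n
  consider "n = 0" | "n = 1" | k where "n = Suc (Suc k)"
    by (metis One_nat_def not0_implies_Suc)
  then show "rising_series (- 1) $ n = (1 - fps_X) $ n"
    by cases (auto simp: rising_series_def rising_coeff_def pochhammer_rec)
qed

text \<open>Lowering the parameter by one multiplies the series by \<open>1 - X\<close>, that is, applies the backward
  difference to the coefficients.\<close>

lemma rising_series_pred_mult_nth_Suc:
  "(rising_series (c - 1) * F) $ Suc k
    = (rising_series c * F) $ Suc k - (rising_series c * F) $ k"
proof -
  have "rising_series (c - 1) * F = (1 - fps_X) * (rising_series c * F)"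
    using rising_series_mult[of "- 1" c] by (simp add: rising_series_minus_1 mult.assoc)
  then show ?thesis
    by (simp add: left_diff_distrib)
qed

lemma taylor_mono_eq_rising_coeff:
  assumes "\<mu> > - 1"
  shows "taylor_mono \<mu> (c + 1 + real k) c = rising_coeff (\<mu> + 1) k"
proof -
  have pole: "\<mu> + 1 \<notin> \<int>\<^sub>\<le>\<^sub>0" "1 + real k + \<mu> \<notin> \<int>\<^sub>\<le>\<^sub>0" "1 + real k \<notin> \<int>\<^sub>\<le>\<^sub>0"
    using assms by (auto elim!: nonpos_Ints_cases)
  have "pochhammer (\<mu> + 1) k = Gamma (1 + real k + \<mu>) / Gamma (\<mu> + 1)"
    using pochhammer_Gamma[OF pole(1), of k] by (simp add: add_ac)
  moreover have "Gamma (1 + real k) = fact k"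
    by (simp add: Gamma_fact)
  ultimately show ?thesis
    using pole by (simp add: taylor_mono_def gen_rising_def rising_coeff_def)
qed

section \<open>Inversion of the fractional difference\<close>

lemma nats_betw_eq_image: "nats_betw c (c + real m) = (\<lambda>k. c + real k) ` {..m}"
  by (auto simp: nats_betw_def nats_from_def)

lemma sum_nats_betw: "(\<Sum>s\<in>nats_betw c (c + real m). f s) = (\<Sum>k\<le>m. f (c + real k))"
  unfolding nats_betw_eq_image by (subst sum.reindex) (auto simp: inj_on_def)

definition grid_series :: "real \<Rightarrow> (real \<Rightarrow> real) \<Rightarrow> real fps" where
  "grid_series a u = Abs_fps (\<lambda>k. u (a + 1 + real k))"

lemma nabla_frac_sum_eq_nth:
  assumes "\<mu> > 0"
  shows "nabla_frac_sum a \<mu> u (a + 1 + real k) = (rising_series \<mu> * grid_series a u) $ k"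
proof -
  have "taylor_mono (\<mu> - 1) (a + 1 + real k) (back_jump a (a + 1 + real j))
      = rising_coeff \<mu> (k - j)" if "j \<le> k" for j
  proof -
    have jump: "back_jump a (a + 1 + real j) = a + real j"
      by (simp add: back_jump_def)
    have shift: "a + 1 + real k = (a + real j) + 1 + real (k - j)"
      using that by simp
    have "taylor_mono (\<mu> - 1) (a + 1 + real k) (back_jump a (a + 1 + real j))
        = rising_coeff (\<mu> - 1 + 1) (k - j)"
      unfolding jump shift using assms by (intro taylor_mono_eq_rising_coeff) simp
    then show ?thesis
      by simp
  qed
  then show ?thesis
    unfolding nabla_frac_sum_def sum_nats_betw mult.commute[of "rising_series \<mu>"] fps_mult_nth
    by (simp add: rising_series_def grid_series_def atLeast0AtMost mult.commute)
qed

lemma nabla_frac_sum_base: "nabla_frac_sum a \<mu> u a = 0"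
proof -
  have "nats_betw (a + 1) a = {}"
    by (auto simp: nats_betw_def nats_from_def)
  then show ?thesis
    by (simp add: nabla_frac_sum_def)
qed

lemma nabla_frac_diff_eq_nth:
  assumes "\<nu> < 2"
  shows "nabla_frac_diff a \<nu> u (a + 1 + real (Suc k))
    = (rising_series (- \<nu>) * grid_series a u) $ Suc k"
proof -
  let ?S = "\<lambda>c. rising_series c * grid_series a u"
  have S: "nabla_frac_sum a (2 - \<nu>) u (a + 1 + real i) = ?S (2 - \<nu>) $ i" for i
    using assms by (intro nabla_frac_sum_eq_nth) simp
  have first: "nabla (nabla_frac_sum a (2 - \<nu>) u) (a + 1 + real i) = ?S (1 - \<nu>) $ i" for i
  proof (cases i)
    case 0
    \<comment> \<open>The sum is \<open>0\<close> at \<open>a\<close>, so here too the backward difference is a multiplication by \<open>1 - X\<close>.\<close>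
    then show ?thesis
      using S[of 0] by (simp add: nabla_def nabla_frac_sum_base rising_series_def)
  next
    case (Suc j)
    have "a + 1 + real i - 1 = a + 1 + real j"
      using Suc by simp
    then show ?thesis
      using rising_series_pred_mult_nth_Suc[of "2 - \<nu>" "grid_series a u" j]
      unfolding nabla_def by (simp only: S Suc) simp
  qed
  have "a + 1 + real (Suc k) - 1 = a + 1 + real k"
    by simp
  then show ?thesis
    using rising_series_pred_mult_nth_Suc[of "1 - \<nu>" "grid_series a u" k]
    unfolding nabla_frac_diff_def nabla_def[of "nabla _"] by (simp only: first) simp
qed

text \<open>The second identity is the first one after multiplication by \<open>1 - X\<close>; it starts one step
  later because \<open>u a\<close> is unrelated to the series.\<close>

lemma variation_of_constants:
  assumes "\<nu> < 2"
    and eqn: "\<And>j. 0 < j \<Longrightarrow> j \<le> k \<Longrightarrow> nabla_frac_diff a \<nu> u (a + 1 + real j) = - f j"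
  shows "u (a + 1 + real k)
      = rising_coeff \<nu> k * u (a + 1) - (\<Sum>j=1..k. rising_coeff \<nu> (k - j) * f j)"
    and "0 < k \<Longrightarrow> nabla u (a + 1 + real k)
      = rising_coeff (\<nu> - 1) k * u (a + 1) - (\<Sum>j=1..k. rising_coeff (\<nu> - 1) (k - j) * f j)"
proof -
  define W where "W = rising_series (- \<nu>) * grid_series a u"
  have W: "W $ j = (if j = 0 then u (a + 1) else - f j)" if "j \<le> k" for j
  proof (cases j)
    case 0
    then show ?thesis
      by (simp add: W_def rising_series_def grid_series_def)
  next
    case (Suc i)
    then show ?thesis
      using nabla_frac_diff_eq_nth[OF \<open>\<nu> < 2\<close>, of a u i] eqn[of j] that by (simp add: W_def)
  qed
  have conv: "(rising_series c * W) $ k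
      = rising_coeff c k * u (a + 1) - (\<Sum>j=1..k. rising_coeff c (k - j) * f j)" for c
  proof -
    have "(rising_series c * W) $ k = (\<Sum>j=0..k. rising_coeff c (k - j) * W $ j)"
      unfolding mult.commute[of "rising_series c"] fps_mult_nth
      by (simp add: rising_series_def mult.commute)
    also have "\<dots> = rising_coeff c k * W $ 0 + (\<Sum>j=1..k. rising_coeff c (k - j) * W $ j)"
      by (simp add: sum.atLeast_Suc_atMost)
    also have "(\<Sum>j=1..k. rising_coeff c (k - j) * W $ j)
        = - (\<Sum>j=1..k. rising_coeff c (k - j) * f j)"
      unfolding sum_negf[symmetric] by (intro sum.cong) (auto simp: W)
    finally show ?thesis
      by (simp add: W)
  qed
  have inv: "rising_series \<nu> * W = grid_series a u"
    using rising_series_mult[of \<nu> "- \<nu>"]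
    by (simp add: W_def mult.assoc[symmetric] rising_series_0)
  show "u (a + 1 + real k)
      = rising_coeff \<nu> k * u (a + 1) - (\<Sum>j=1..k. rising_coeff \<nu> (k - j) * f j)"
    using conv[of \<nu>] by (simp add: inv grid_series_def)
  assume "0 < k"
  then obtain i where i: "k = Suc i"
    by (cases k) auto
  have "nabla u (a + 1 + real k) = (rising_series (\<nu> - 1) * W) $ k"
    using rising_series_pred_mult_nth_Suc[of \<nu> W i]
    by (simp add: i inv grid_series_def nabla_def add_ac)
  then show "nabla u (a + 1 + real k)
      = rising_coeff (\<nu> - 1) k * u (a + 1) - (\<Sum>j=1..k. rising_coeff (\<nu> - 1) (k - j) * f j)"
    by (simp add: conv)
qed

section \<open>The Green kernel\<close>

text \<open>The right boundary functional \<open>\<gamma> u + \<delta> \<nabla>u\<close>, applied to the fundamental solution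
  \<open>H\<^bsub>\<nu>-1\<^esub>(\<cdot>, a)\<close>.\<close>

definition right_bc :: "real \<Rightarrow> real \<Rightarrow> real \<Rightarrow> nat \<Rightarrow> real" where
  "right_bc \<nu> \<gamma> \<delta> k = \<gamma> * rising_coeff \<nu> k + \<delta> * rising_coeff (\<nu> - 1) k"

text \<open>The arguments \<open>k\<close> and \<open>j\<close> stand for the grid points \<open>a + 1 + k\<close> and \<open>a + 1 + j\<close>.\<close>

definition green :: "real \<Rightarrow> real \<Rightarrow> real \<Rightarrow> nat \<Rightarrow> nat \<Rightarrow> nat \<Rightarrow> real" where
  "green \<nu> \<gamma> \<delta> N k j =
     rising_coeff \<nu> k * right_bc \<nu> \<gamma> \<delta> (N - j) / right_bc \<nu> \<gamma> \<delta> N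
     - (if j \<le> k then rising_coeff \<nu> (k - j) else 0)"

lemma right_bc_pos:
  assumes "1 < \<nu>" "\<gamma> \<ge> 0" "\<delta> \<ge> 0" "\<gamma> > 0 \<or> \<delta> > 0"
  shows "right_bc \<nu> \<gamma> \<delta> k > 0"
proof -
  have "rising_coeff \<nu> k > 0" "rising_coeff (\<nu> - 1) k > 0"
    using assms by (auto intro: rising_coeff_pos)
  with assms show ?thesis
    unfolding right_bc_def by (auto intro: add_pos_nonneg add_nonneg_pos)
qed

lemma right_bc_le:
  assumes "1 < \<nu>" "\<nu> < 2" "\<gamma> \<ge> 0" "\<delta> \<ge> 0" "k \<le> N"
  shows "right_bc \<nu> \<gamma> \<delta> k \<le> \<gamma> * rising_coeff \<nu> N + \<delta>"
proof -
  have "rising_coeff \<nu> k \<le> rising_coeff \<nu> N"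
    using rising_coeff_less[of \<nu> k N] assms by (cases "k = N") auto
  then have "\<gamma> * rising_coeff \<nu> k \<le> \<gamma> * rising_coeff \<nu> N"
    using assms by (intro mult_left_mono)
  moreover have "\<delta> * rising_coeff (\<nu> - 1) k \<le> \<delta> * 1"
    using assms by (intro mult_left_mono rising_coeff_le_1) auto
  ultimately show ?thesis
    by (simp add: right_bc_def)
qed

text \<open>Both parts of the kernel are nonnegative, so each of them bounds one sign of it. The
  difference is strictly below the first bound at \<open>k = N\<close>, because the subtracted part is then
  positive, and at \<open>k < N\<close>, because \<open>H\<^bsub>\<nu>-1\<^esub>\<close> is strictly increasing. The restriction \<open>0 < j\<close>, which
  holds because the equation is required only from \<open>a + 2\<close> on, makes \<open>rising_coeff \<nu> (N - j)\<close> and the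
  subtracted part strictly smaller than \<open>h\<close>; the second bound is strict for this reason.\<close>

lemma abs_green_bounds:
  assumes nu: "1 < \<nu>" "\<nu> < 2"
    and nonneg: "\<gamma> \<ge> 0" "\<delta> \<ge> 0" "\<gamma> > 0 \<or> \<delta> > 0"
    and idx: "k \<le> N" "0 < j" "j \<le> N"
  defines "h \<equiv> rising_coeff \<nu> N" and "g \<equiv> \<bar>green \<nu> \<gamma> \<delta> N k j\<bar>"
  shows "g * right_bc \<nu> \<gamma> \<delta> N < h * (\<gamma> * h + \<delta>)"
    and "g * \<gamma> < \<gamma> * h + \<delta>"
proof -
  define D where "D = right_bc \<nu> \<gamma> \<delta> N"
  define R where "R = right_bc \<nu> \<gamma> \<delta> (N - j)"
  define T where "T = (if j \<le> k then rising_coeff \<nu> (k - j) else 0)"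
  define x where "x = rising_coeff \<nu> k"
  define y where "y = rising_coeff \<nu> (N - j)"
  define d where "d = rising_coeff (\<nu> - 1) N"
  define e where "e = rising_coeff (\<nu> - 1) (N - j)"
  have pos: "D > 0" "R > 0"
    using nu nonneg by (auto simp: D_def R_def intro: right_bc_pos)
  have le: "D \<le> \<gamma> * h + \<delta>" "R \<le> \<gamma> * h + \<delta>"
    using nu nonneg by (auto simp: D_def R_def h_def intro: right_bc_le)
  have D: "D = \<gamma> * h + \<delta> * d" and R: "R = \<gamma> * y + \<delta> * e"
    by (simp_all add: D_def R_def right_bc_def h_def d_def y_def e_def)
  have h: "h > 0" "x > 0" "y > 0" "d > 0" "e > 0" "e \<le> 1"
    using nu by (auto simp: h_def x_def y_def d_def e_def intro: rising_coeff_pos rising_coeff_le_1)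
  have yh: "y < h"
    using nu idx by (auto simp: y_def h_def intro: rising_coeff_less)
  have xh: "x \<le> h" "k \<noteq> N \<Longrightarrow> x < h"
    using rising_coeff_less[of \<nu> k N] nu idx by (cases "k = N"; simp add: x_def h_def)+
  have T: "0 \<le> T" "T < h" "k = N \<Longrightarrow> 0 < T"
    using nu idx h(1) rising_coeff_pos[of \<nu> "k - j"] rising_coeff_less[of \<nu> "k - j" N]
    by (auto simp: T_def h_def)
  have green: "green \<nu> \<gamma> \<delta> N k j = x * R / D - T"
    by (simp add: green_def x_def R_def D_def T_def)
  then have gD: "green \<nu> \<gamma> \<delta> N k j * D = x * R - T * D"
    using pos by (simp add: field_simps)
  have pos_bound: "x * R - T * D < h * (\<gamma> * h + \<delta>)"
  proof (cases "k = N")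
    case True
    then have "T * D > 0"
      using T pos by simp
    moreover have "x * R \<le> h * (\<gamma> * h + \<delta>)"
      using xh le h pos by (intro mult_mono) auto
    ultimately show ?thesis
      by simp
  next
    case False
    have "x * R < h * R"
      using xh False pos by simp
    also have "\<dots> \<le> h * (\<gamma> * h + \<delta>)"
      using le h by (intro mult_left_mono) auto
    finally show ?thesis
      using T pos by (smt (verit) mult_nonneg_nonneg)
  qed
  have neg_bound: "T * D - x * R < h * (\<gamma> * h + \<delta>)"
  proof -
    have "T * D < h * D"
      using T pos by simp
    also have "\<dots> \<le> h * (\<gamma> * h + \<delta>)"
      using le h by (intro mult_left_mono) auto
    finally show ?thesis
      using h pos by (smt (verit) mult_pos_pos)
  qed
  have "\<bar>green \<nu> \<gamma> \<delta> N k j * D\<bar> < h * (\<gamma> * h + \<delta>)"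
    unfolding gD using pos_bound neg_bound by linarith
  then show "g * right_bc \<nu> \<gamma> \<delta> N < h * (\<gamma> * h + \<delta>)"
    using pos by (simp add: g_def abs_mult D_def)
  show "g * \<gamma> < \<gamma> * h + \<delta>"
  proof (cases "\<gamma> = 0")
    case True
    then show ?thesis
      using nonneg by simp
  next
    case False
    then have \<gamma>: "\<gamma> > 0"
      using nonneg by simp
    \<comment> \<open>Both sides are quadratic forms in \<open>\<gamma>\<close> and \<open>\<delta>\<close>, compared coefficient by coefficient.\<close>
    have "h * R * \<gamma> < (\<gamma> * h + \<delta>) * D"
    proof -
      have "\<gamma> * \<gamma> * (h * y) < \<gamma> * \<gamma> * (h * h)"
        using \<gamma> yh h by simp
      moreover have "\<gamma> * \<delta> * (h * e) \<le> \<gamma> * \<delta> * (h * 1)"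
        using \<gamma> nonneg h by (intro mult_left_mono) auto
      moreover have "0 \<le> \<gamma> * \<delta> * (h * d)" "0 \<le> \<delta> * \<delta> * d"
        using \<gamma> nonneg h by auto
      ultimately show ?thesis
        by (simp add: D R algebra_simps)
    qed
    moreover have "x * R * \<gamma> \<le> h * R * \<gamma>"
      using xh pos \<gamma> by (intro mult_right_mono) auto
    ultimately have "x * R * \<gamma> < (\<gamma> * h + \<delta>) * D"
      by linarith
    then have up: "x * R / D * \<gamma> < \<gamma> * h + \<delta>"
      using pos by (simp add: field_simps)
    have "T * \<gamma> < h * \<gamma>"
      using T \<gamma> by simp
    then have "T * \<gamma> < \<gamma> * h + \<delta>"
      using nonneg by (simp add: mult.commute)
    moreover have "0 \<le> T * \<gamma>" "0 \<le> x * R / D * \<gamma>"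
      using T \<gamma> h pos by auto
    ultimately have "\<bar>(x * R / D - T) * \<gamma>\<bar> < \<gamma> * h + \<delta>"
      using up unfolding left_diff_distrib by linarith
    then show ?thesis
      using \<gamma> by (simp add: g_def green abs_mult)
  qed
qed

text \<open>The mediant step, with weights \<open>A\<close> and \<open>\<alpha>\<close>.\<close>

lemma abs_green_less:
  assumes "1 < \<nu>" "\<nu> < 2"
    and "\<gamma> \<ge> 0" "\<delta> \<ge> 0" "\<gamma> > 0 \<or> \<delta> > 0"
    and "k \<le> N" "0 < j" "j \<le> N"
    and "A \<ge> 0" "\<alpha> \<ge> 0"
    and xi: "0 < A * \<gamma> + \<alpha> * right_bc \<nu> \<gamma> \<delta> N"
  shows "\<bar>green \<nu> \<gamma> \<delta> N k j\<bar>
    < (\<alpha> * rising_coeff \<nu> N + A) * (\<gamma> * rising_coeff \<nu> N + \<delta>)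
      / (A * \<gamma> + \<alpha> * right_bc \<nu> \<gamma> \<delta> N)"
proof -
  let ?h = "rising_coeff \<nu> N" and ?D = "right_bc \<nu> \<gamma> \<delta> N" and ?g = "\<bar>green \<nu> \<gamma> \<delta> N k j\<bar>"
  note bounds = abs_green_bounds[OF assms(1-8)]
  have "A > 0 \<or> \<alpha> > 0"
    using xi assms(9,10) by (cases "A = 0"; cases "\<alpha> = 0") auto
  then have "A * (?g * \<gamma>) + \<alpha> * (?g * ?D) < A * (\<gamma> * ?h + \<delta>) + \<alpha> * (?h * (\<gamma> * ?h + \<delta>))"
  proof
    assume "A > 0"
    then show ?thesis
      using bounds assms(10)
      by (intro add_less_le_mono mult_strict_left_mono mult_left_mono) auto
  next
    assume "\<alpha> > 0"
    then show ?thesis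
      using bounds assms(9)
      by (intro add_le_less_mono mult_strict_left_mono mult_left_mono) auto
  qed
  then show ?thesis
    using xi by (simp add: pos_less_divide_eq algebra_simps)
qed

text \<open>The right boundary condition is a linear equation for \<open>u (a + 1)\<close> with the nonzero leading
  coefficient \<open>right_bc \<nu> \<gamma> \<delta> N\<close>; substituting its solution into the variation of constants formula
  produces the kernel.\<close>

lemma green_representation:
  assumes "\<nu> < 2" "0 < N" "k \<le> N"
    and eqn: "\<And>j. 0 < j \<Longrightarrow> j \<le> N \<Longrightarrow> nabla_frac_diff a \<nu> u (a + 1 + real j) = - f j"
    and bc: "\<gamma> * u (a + 1 + real N) + \<delta> * nabla u (a + 1 + real N) = 0"
    and D: "right_bc \<nu> \<gamma> \<delta> N \<noteq> 0"
  shows "u (a + 1 + real k) = (\<Sum>j=1..N. green \<nu> \<gamma> \<delta> N k j * f j)"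
proof -
  let ?D = "right_bc \<nu> \<gamma> \<delta> N"
  have sum_eq: "(\<Sum>j=1..N. right_bc \<nu> \<gamma> \<delta> (N - j) * f j)
      = \<gamma> * (\<Sum>j=1..N. rising_coeff \<nu> (N - j) * f j)
        + \<delta> * (\<Sum>j=1..N. rising_coeff (\<nu> - 1) (N - j) * f j)"
    by (simp add: right_bc_def distrib_right sum.distrib sum_distrib_left mult.assoc)
  have u_eq: "u (a + 1 + real N)
      = rising_coeff \<nu> N * u (a + 1) - (\<Sum>j=1..N. rising_coeff \<nu> (N - j) * f j)"
    by (intro variation_of_constants(1) \<open>\<nu> < 2\<close> eqn)
  have nabla_eq: "nabla u (a + 1 + real N)
      = rising_coeff (\<nu> - 1) N * u (a + 1) - (\<Sum>j=1..N. rising_coeff (\<nu> - 1) (N - j) * f j)"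
    by (intro variation_of_constants(2) \<open>\<nu> < 2\<close> eqn \<open>0 < N\<close>)
  have "?D * u (a + 1) - (\<Sum>j=1..N. right_bc \<nu> \<gamma> \<delta> (N - j) * f j)
      = \<gamma> * u (a + 1 + real N) + \<delta> * nabla u (a + 1 + real N)"
    unfolding sum_eq u_eq nabla_eq right_bc_def[of _ _ _ N] by (simp add: algebra_simps)
  then have "u (a + 1) = (\<Sum>j=1..N. right_bc \<nu> \<gamma> \<delta> (N - j) * f j) / ?D"
    using bc D by (simp add: field_simps)
  moreover have "u (a + 1 + real k)
      = rising_coeff \<nu> k * u (a + 1) - (\<Sum>j=1..k. rising_coeff \<nu> (k - j) * f j)"
    using \<open>k \<le> N\<close> by (intro variation_of_constants(1) \<open>\<nu> < 2\<close> eqn) auto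
  moreover have "(\<Sum>j=1..k. rising_coeff \<nu> (k - j) * f j)
      = (\<Sum>j=1..N. (if j \<le> k then rising_coeff \<nu> (k - j) else 0) * f j)"
    using \<open>k \<le> N\<close> by (intro sum.mono_neutral_cong_left) auto
  ultimately show ?thesis
    by (simp add: green_def left_diff_distrib sum_subtractf sum_divide_distrib sum_distrib_left
        mult.assoc)
qed

section \<open>The Lyapunov-type inequality\<close>

text \<open>The norm estimate for the kernel, evaluated where \<open>\<bar>v\<bar>\<close> is maximal. Strictness comes from
  the strict bound on the kernel: if \<open>p\<close> vanished on \<open>1, \<dots>, N\<close>, so would \<open>v\<close>.\<close>

lemma one_less_of_kernel_bound:
  fixes v p :: "nat \<Rightarrow> real"
  assumes rep: "\<And>k. k \<le> N \<Longrightarrow> v k = (\<Sum>j=1..N. G k j * (p j * v j))"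
    and G: "\<And>k j. k \<le> N \<Longrightarrow> 0 < j \<Longrightarrow> j \<le> N \<Longrightarrow> \<bar>G k j\<bar> < C"
    and nz: "k\<^sub>0 \<le> N" "v k\<^sub>0 \<noteq> 0"
  shows "1 < C * (\<Sum>j=1..N. \<bar>p j\<bar>)"
proof -
  obtain k where k: "k \<le> N" and max: "\<And>i. i \<le> N \<Longrightarrow> \<bar>v i\<bar> \<le> \<bar>v k\<bar>"
    using arg_min_if_finite(1)[of "{..N}" "\<lambda>i. - \<bar>v i\<bar>"]
      arg_min_least[of "{..N}" _ "\<lambda>i. - \<bar>v i\<bar>"]
    by auto
  have vk: "\<bar>v k\<bar> > 0"
    using max[OF nz(1)] nz(2) by linarith
  have ex: "\<exists>i\<in>{1..N}. p i \<noteq> 0"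
  proof (rule ccontr)
    assume "\<not> ?thesis"
    then have "v k = 0"
      using rep[OF k] by (simp add: sum.neutral)
    with vk show False
      by simp
  qed
  have "\<bar>v k\<bar> \<le> (\<Sum>j=1..N. \<bar>G k j * (p j * v j)\<bar>)"
    using rep[OF k] sum_abs by metis
  also have "\<dots> \<le> (\<Sum>j=1..N. \<bar>G k j\<bar> * \<bar>p j\<bar> * \<bar>v k\<bar>)"
    by (intro sum_mono) (auto simp: abs_mult mult.assoc intro!: mult_left_mono max)
  also have "\<dots> < (\<Sum>j=1..N. C * \<bar>p j\<bar> * \<bar>v k\<bar>)"
  proof (rule sum_strict_mono_ex1)
    show "\<forall>j\<in>{1..N}. \<bar>G k j\<bar> * \<bar>p j\<bar> * \<bar>v k\<bar> \<le> C * \<bar>p j\<bar> * \<bar>v k\<bar>"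
      using less_imp_le[OF G[OF k]] by (auto intro!: mult_right_mono)
    show "\<exists>j\<in>{1..N}. \<bar>G k j\<bar> * \<bar>p j\<bar> * \<bar>v k\<bar> < C * \<bar>p j\<bar> * \<bar>v k\<bar>"
    proof -
      obtain i where i: "i \<in> {1..N}" "p i \<noteq> 0"
        using ex by blast
      then have "\<bar>G k i\<bar> * \<bar>p i\<bar> * \<bar>v k\<bar> < C * \<bar>p i\<bar> * \<bar>v k\<bar>"
        using G[OF k, of i] vk by (intro mult_strict_right_mono) auto
      with i show ?thesis
        by blast
    qed
  qed simp
  also have "\<dots> = C * (\<Sum>j=1..N. \<bar>p j\<bar>) * \<bar>v k\<bar>"
    by (simp add: sum_distrib_left sum_distrib_right)
  finally show ?thesis
    using vk by simp
qed

theorem theorem3p5: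
  fixes a b \<nu> \<alpha> \<beta> \<gamma> \<delta> \<xi> \<Omega> :: real
    and q u :: "real \<Rightarrow> real"
  assumes ab: "b - a \<in> nats_from 1"
    and nu: "1 < \<nu>" "\<nu> < 2"
    and nondeg: "\<alpha>\<^sup>2 + \<beta>\<^sup>2 > 0" "\<gamma>\<^sup>2 + \<delta>\<^sup>2 > 0"
    and nonneg: "\<alpha> \<ge> 0" "\<beta> \<ge> 0" "\<gamma> \<ge> 0" "\<delta> \<ge> 0"
    and beta_ge: "\<beta> \<ge> \<alpha>"
    and xi: "\<xi> = (\<beta> - \<alpha>) * \<gamma> + \<alpha> * \<gamma> * taylor_mono (\<nu> - 1) b a
                  + \<alpha> * \<delta> * taylor_mono (\<nu> - 2) b a"
    and xi_nz: "\<xi> \<noteq> 0"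
    and Omega: "\<Omega> = 1 / \<xi> *
          (\<alpha> * \<gamma> * taylor_mono (\<nu> - 1) b a * taylor_mono (\<nu> - 1) b a
           + \<alpha> * \<delta> * taylor_mono (\<nu> - 1) b a
           + (\<beta> - \<alpha>) * \<gamma> * taylor_mono (\<nu> - 1) b a
           + (\<beta> - \<alpha>) * \<delta>)"
    and eqn: "\<forall>t\<in>nats_betw (a + 2) b. nabla_frac_diff a \<nu> u t + q t * u t = 0"
    and bc_left: "\<alpha> * u (a + 1) - \<beta> * nabla u (a + 1) = 0"
    and bc_right: "\<gamma> * u b + \<delta> * nabla u b = 0"
    and nontrivial: "\<exists>t\<in>nats_betw a b. u t \<noteq> 0"
  shows "(\<Sum>s\<in>nats_betw (a + 1) b. \<bar>q s\<bar>) > 1 / \<Omega>"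
proof -
  obtain N :: nat where b: "b = a + 1 + real N"
    using ab by (auto simp: nats_from_def algebra_simps)
  let ?h = "rising_coeff \<nu> N" and ?D = "right_bc \<nu> \<gamma> \<delta> N"
  have H: "taylor_mono (\<nu> - 1) b a = ?h" "taylor_mono (\<nu> - 2) b a = rising_coeff (\<nu> - 1) N"
    using taylor_mono_eq_rising_coeff[of "\<nu> - 1" a N] taylor_mono_eq_rising_coeff[of "\<nu> - 2" a N] nu
    by (simp_all add: b)
  have beta: "\<beta> > 0" and gd: "\<gamma> > 0 \<or> \<delta> > 0"
    using nondeg nonneg beta_ge by (auto simp: less_le)
  have D: "?D > 0"
    using nu nonneg gd by (intro right_bc_pos) auto
  have xi': "\<xi> = (\<beta> - \<alpha>) * \<gamma> + \<alpha> * ?D"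
    by (simp add: xi H right_bc_def algebra_simps)
  have xi_pos: "\<xi> > 0"
  proof -
    have "0 \<le> (\<beta> - \<alpha>) * \<gamma>" "0 \<le> \<alpha> * ?D"
      using nonneg beta_ge D by auto
    then show ?thesis
      using xi_nz xi' by linarith
  qed
  have Omega': "\<Omega> = (\<alpha> * ?h + (\<beta> - \<alpha>)) * (\<gamma> * ?h + \<delta>) / \<xi>"
    unfolding Omega H times_divide_eq_left mult_1 by (intro arg_cong[where f = "\<lambda>x. x / \<xi>"]) algebra
  have left: "\<beta> * u a = (\<beta> - \<alpha>) * u (a + 1)"
    using bc_left by (simp add: nabla_def algebra_simps)
  define v where "v k = u (a + 1 + real k)" for k
  obtain k\<^sub>0 where k0: "k\<^sub>0 \<le> N" "v k\<^sub>0 \<noteq> 0"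
  proof (cases "u (a + 1) = 0")
    case True
    \<comment> \<open>The left boundary condition then gives \<open>u a = 0\<close>, so \<open>u\<close> is nonzero at a later point.\<close>
    then have "u a = 0"
      using left beta by simp
    obtain n :: nat where n: "a + real n \<le> b" "u (a + real n) \<noteq> 0"
      using nontrivial by (auto simp: nats_betw_def nats_from_def)
    with \<open>u a = 0\<close> obtain m where "n = Suc m"
      by (cases n) auto
    with n show ?thesis
      by (intro that[of m]) (auto simp: v_def b add_ac)
  next
    case False
    then show ?thesis
      by (intro that[of 0]) (auto simp: v_def)
  qed
  have N: "0 < N"
  proof (rule ccontr)
    assume "\<not> 0 < N"
    then have N0: "N = 0" "b = a + 1"
      by (simp_all add: b)
    have "\<xi> * u (a + 1) = \<beta> * (\<gamma> * u b + \<delta> * nabla u b)"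
      using arg_cong[OF left, of "\<lambda>x. \<delta> * x"] N0
      by (simp add: xi' right_bc_def nabla_def algebra_simps)
    then have "u (a + 1) = 0"
      using bc_right xi_nz by simp
    with k0 N0 show False
      by (simp add: v_def)
  qed
  define p where "p k = q (a + 1 + real k)" for k
  have eq: "nabla_frac_diff a \<nu> u (a + 1 + real j) = - (p j * v j)" if j: "0 < j" "j \<le> N" for j
  proof -
    obtain i where "j = Suc i"
      using j by (cases j) auto
    then have "a + 1 + real j = a + 2 + real i"
      by simp
    moreover have "a + 1 + real j \<le> b"
      using j by (simp add: b)
    ultimately have "a + 1 + real j \<in> nats_betw (a + 2) b"
      unfolding nats_betw_def nats_from_def by blast
    then show ?thesis
      using eqn by (auto simp: p_def v_def add_eq_0_iff2)
  qed
  have "v k = (\<Sum>j=1..N. green \<nu> \<gamma> \<delta> N k j * (p j * v j))" if "k \<le> N" for k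
    unfolding v_def[of k] using nu N that eq bc_right D
    by (intro green_representation) (auto simp: b)
  moreover have "\<bar>green \<nu> \<gamma> \<delta> N k j\<bar> < \<Omega>" if "k \<le> N" "0 < j" "j \<le> N" for k j
    unfolding Omega' xi' using nu nonneg gd that beta_ge xi_pos
    by (intro abs_green_less) (auto simp: xi')
  ultimately have less: "1 < \<Omega> * (\<Sum>j=1..N. \<bar>p j\<bar>)" and "\<Omega> > 0"
    using one_less_of_kernel_bound[of N v "green \<nu> \<gamma> \<delta> N" p \<Omega>] k0 N
    by (blast, meson abs_ge_zero le_less_trans order_refl zero_le)
  then have "1 / \<Omega> < (\<Sum>j=1..N. \<bar>p j\<bar>)"
    by (simp add: pos_divide_less_eq mult.commute)
  also have "\<dots> \<le> (\<Sum>j\<le>N. \<bar>p j\<bar>)"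
    by (intro sum_mono2) auto
  also have "\<dots> = (\<Sum>s\<in>nats_betw (a + 1) b. \<bar>q s\<bar>)"
    by (simp add: b sum_nats_betw p_def)
  finally show ?thesis .
qed

end
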